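(* Let $\kappa$ be an infinite cardinal, let $A$ be a $\kappa$-subdirectly irreducible algebraic system, let $\{B_i\}_{i\in \mathbb I}$ be a family of algebraic systems indexed by a set $\mathbb I$, and let $f: A \hookrightarrow \prod_{i\in \mathbb I} B_i$ be an indecomposable embedding. Then there is a $\kappa$-complete ultrafilter $\mathscr U$ on the set $\mathbb I$ such that the composition of $f$ with the canonical homomorphism $\prod_{i\in \mathbb I} B_i \to \prod_{\mathscr U} B_i$ is an embedding.
   Context: All algebraic systems (algebras in the sense of universal algebra) are of the same fixed but arbitrary signature; an embedding is an injective homomorphism. For $\mathbb J \subseteq \mathbb I$, let $p_{\mathbb I,\mathbb J}: \prod_{i\in \mathbb I} B_i \to \prod_{i\in \mathbb J} B_i$ be the canonical projection, $(p_{\mathbb I,\mathbb J}(b))(i) = b(i)$ for $i \in \mathbb J$. For an embedding $f: A \hookrightarrow \prod_{i \in \mathbb I} B_i$, let $\mathscr U(f)$ be the set of those subsets $\mathbb J \subseteq \mathbb I$ for which there is an embedding $f_{\mathbb J}: A \to \prod_{i\in \mathbb J} B_i$ with $p_{\mathbb I,\mathbb J}(f(a)) = f_{\mathbb J}(a)$ for all $a \in A$ (equivalently, the map $a \mapsto p_{\mathbb I,\mathbb J}(f(a))$ is injective). Given a cardinal $\kappa$, an algebraic system $A$ is $\kappa$-subdirectly irreducible if for any embedding $f: A \hookrightarrow \prod_{i \in \mathbb I} B_i$ into the direct product of a family of algebraic systems with $|\mathbb I| < \kappa$, there is $i_0 \in \mathbb I$ such that $\{i_0\} \in \mathscr U(f)$.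 An embedding $f: A \hookrightarrow \prod_{i \in \mathbb I} B_i$ is indecomposable if for any $\mathbb J \subseteq \mathbb I$, exactly one of $\mathbb J \in \mathscr U(f)$ and $\mathbb I \backslash \mathbb J \in \mathscr U(f)$ holds. A filter is $\kappa$-complete if it is closed under intersections of fewer than $\kappa$ of its elements. $\prod_{\mathscr U} B_i$ denotes the ultraproduct over $\mathscr U$, i.e. the quotient of $\prod_{i\in \mathbb I} B_i$ by the congruence identifying $a$ and $b$ if and only if $\{ i\in \mathbb I \mid a(i) = b(i)\} \in \mathscr U$. *)

theory Defs
  imports "HOL-Library.FuncSet"
begin

unbundle cardinal_syntax

text \<open>
  Signatures are finitary.  Operation symbols form an arbitrary, possibly empty, set; arguments of
  an operation are passed as a list, and an operation is meaningful only on lists of elements of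
  the carrier whose length is the arity of the symbol.  Carriers may be empty; the
  factors of a product into which a nonempty algebra embeds are nonempty anyway.
\<close>

record 'f signature =
  symbols :: "'f set"
  arity :: "'f \<Rightarrow> nat"

record ('f, 'a) algebra =
  carrier :: "'a set"
  opn :: "'f \<Rightarrow> 'a list \<Rightarrow> 'a"

definition argument_lists :: "'f signature \<Rightarrow> ('f, 'a) algebra \<Rightarrow> 'f \<Rightarrow> 'a list set" where
  "argument_lists \<Sigma> A s = {xs. set xs \<subseteq> carrier A \<and> length xs = arity \<Sigma> s}"

definition is_algebra :: "'f signature \<Rightarrow> ('f, 'a) algebra \<Rightarrow> bool" where
  "is_algebra \<Sigma> A \<longleftrightarrow>
     (\<forall>s \<in> symbols \<Sigma>. \<forall>xs \<in> argument_lists \<Sigma> A s. opn A s xs \<in> carrier A)"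

definition homomorphism ::
    "'f signature \<Rightarrow> ('f, 'a) algebra \<Rightarrow> ('f, 'b) algebra \<Rightarrow> ('a \<Rightarrow> 'b) \<Rightarrow> bool" where
  "homomorphism \<Sigma> A B h \<longleftrightarrow>
     (\<forall>a \<in> carrier A. h a \<in> carrier B) \<and>
     (\<forall>s \<in> symbols \<Sigma>. \<forall>xs \<in> argument_lists \<Sigma> A s. h (opn A s xs) = opn B s (map h xs))"

definition embedding ::
    "'f signature \<Rightarrow> ('f, 'a) algebra \<Rightarrow> ('f, 'b) algebra \<Rightarrow> ('a \<Rightarrow> 'b) \<Rightarrow> bool" where
  "embedding \<Sigma> A B h \<longleftrightarrow> homomorphism \<Sigma> A B h \<and> inj_on h (carrier A)"

definition product_algebra :: "'i set \<Rightarrow> ('i \<Rightarrow> ('f, 'b) algebra) \<Rightarrow> ('f, 'i \<Rightarrow> 'b) algebra" where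
  "product_algebra I B =
     \<lparr>carrier = (\<Pi>\<^sub>E i\<in>I. carrier (B i)),
      opn = (\<lambda>s bs. \<lambda>i\<in>I. opn (B i) s (map (\<lambda>b. b i) bs))\<rparr>"

text \<open>
  The set \<open>\<U>(f)\<close> of the embedding \<open>f\<close>.  As elements of a product over \<open>I\<close> are
  extensional functions, the projection onto the product over \<open>J \<subseteq> I\<close> is \<open>restrict\<close>.
\<close>

definition embedding_sets ::
    "'f signature \<Rightarrow> ('f, 'a) algebra \<Rightarrow> 'i set \<Rightarrow> ('i \<Rightarrow> ('f, 'b) algebra) \<Rightarrow> ('a \<Rightarrow> 'i \<Rightarrow> 'b)
      \<Rightarrow> 'i set set" where
  "embedding_sets \<Sigma> A I B f =
     {J. J \<subseteq> I \<and> (\<exists>g. embedding \<Sigma> A (product_algebra J B) g \<and>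
                       (\<forall>a \<in> carrier A. restrict (f a) J = g a))}"

definition indecomposable_embedding ::
    "'f signature \<Rightarrow> ('f, 'a) algebra \<Rightarrow> 'i set \<Rightarrow> ('i \<Rightarrow> ('f, 'b) algebra) \<Rightarrow> ('a \<Rightarrow> 'i \<Rightarrow> 'b)
      \<Rightarrow> bool" where
  "indecomposable_embedding \<Sigma> A I B f \<longleftrightarrow>
     embedding \<Sigma> A (product_algebra I B) f \<and>
     (\<forall>J \<subseteq> I. (J \<in> embedding_sets \<Sigma> A I B f) \<noteq> (I - J \<in> embedding_sets \<Sigma> A I B f))"

text \<open>
  Subdirect irreducibility quantifies over families of algebras with arbitrary carriers and
  arbitrary index sets, and a formula of HOL cannot quantify over their types.  The types are
  therefore parameters of the first definition.  The second one takes the index sets from the type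
  underlying the cardinal \<open>\<kappa>\<close> and the carriers from the type underlying \<open>A\<close>; the theorem
  \<open>kappa_subdirectly_irreducible_all_types\<close> below shows that this loses nothing.
\<close>

definition kappa_subdirectly_irreducible_in ::
    "'i itself \<Rightarrow> 'b itself \<Rightarrow> 'k rel \<Rightarrow> 'f signature \<Rightarrow> ('f, 'a) algebra \<Rightarrow> bool" where
  "kappa_subdirectly_irreducible_in TI TB \<kappa> \<Sigma> A \<longleftrightarrow>
     (\<forall>(I :: 'i set) (B :: 'i \<Rightarrow> ('f, 'b) algebra) f.
        |I| <o \<kappa> \<longrightarrow> (\<forall>i\<in>I. is_algebra \<Sigma> (B i)) \<longrightarrow> embedding \<Sigma> A (product_algebra I B) f \<longrightarrow>
        (\<exists>i\<^sub>0\<in>I. {i\<^sub>0} \<in> embedding_sets \<Sigma> A I B f))"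

definition kappa_subdirectly_irreducible ::
    "'k rel \<Rightarrow> 'f signature \<Rightarrow> ('f, 'a) algebra \<Rightarrow> bool" where
  "kappa_subdirectly_irreducible (\<kappa> :: 'k rel) \<Sigma> (A :: ('f, 'a) algebra) \<longleftrightarrow>
     kappa_subdirectly_irreducible_in TYPE('k) TYPE('a) \<kappa> \<Sigma> A"

text \<open>
  A filter on the set \<open>I\<close> is represented by a filter on the type which contains \<open>I\<close>, that
  is, a filter below \<open>principal I\<close>; a set \<open>J \<subseteq> I\<close> belongs to it if eventually \<open>i \<in> J\<close>.
\<close>

definition ultrafilter_on :: "'i set \<Rightarrow> 'i filter \<Rightarrow> bool" where
  "ultrafilter_on I U \<longleftrightarrow>
     U \<le> principal I \<and> U \<noteq> bot \<and>
     (\<forall>J \<subseteq> I. eventually (\<lambda>i. i \<in> J) U \<or> eventually (\<lambda>i. i \<in> I - J) U)"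

definition kappa_complete :: "'k rel \<Rightarrow> 'i filter \<Rightarrow> bool" where
  "kappa_complete \<kappa> U \<longleftrightarrow>
     (\<forall>S :: 'i set set. |S| <o \<kappa> \<longrightarrow> (\<forall>J\<in>S. eventually (\<lambda>i. i \<in> J) U) \<longrightarrow>
        eventually (\<lambda>i. i \<in> \<Inter>S) U)"

definition quotient_algebra :: "('f, 'a) algebra \<Rightarrow> 'a rel \<Rightarrow> ('f, 'a set) algebra" where
  "quotient_algebra A r =
     \<lparr>carrier = carrier A // r,
      opn = (\<lambda>s Xs. \<Union>xs \<in> {xs. list_all2 (\<in>) xs Xs}. r `` {opn A s xs})\<rparr>"

definition ultraproduct_rel :: "'i set \<Rightarrow> ('i \<Rightarrow> ('f, 'b) algebra) \<Rightarrow> 'i filter \<Rightarrow> ('i \<Rightarrow> 'b) rel" where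
  "ultraproduct_rel I B U =
     {(a, b). a \<in> carrier (product_algebra I B) \<and> b \<in> carrier (product_algebra I B) \<and>
              eventually (\<lambda>i. a i = b i) U}"

definition ultraproduct ::
    "'i set \<Rightarrow> ('i \<Rightarrow> ('f, 'b) algebra) \<Rightarrow> 'i filter \<Rightarrow> ('f, ('i \<Rightarrow> 'b) set) algebra" where
  "ultraproduct I B U = quotient_algebra (product_algebra I B) (ultraproduct_rel I B U)"

definition ultraproduct_map ::
    "'i set \<Rightarrow> ('i \<Rightarrow> ('f, 'b) algebra) \<Rightarrow> 'i filter \<Rightarrow> ('i \<Rightarrow> 'b) \<Rightarrow> ('i \<Rightarrow> 'b) set" where
  "ultraproduct_map I B U b = ultraproduct_rel I B U `` {b}"

lemma in_embedding_sets_iff: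
  assumes f: "embedding \<Sigma> A (product_algebra I B) f"
  shows "J \<in> embedding_sets \<Sigma> A I B f \<longleftrightarrow>
           J \<subseteq> I \<and> inj_on (\<lambda>a. restrict (f a) J) (carrier A)"
proof
  assume "J \<in> embedding_sets \<Sigma> A I B f"
  then obtain g where "J \<subseteq> I" and "inj_on g (carrier A)"
    and "\<forall>a \<in> carrier A. restrict (f a) J = g a"
    by (auto simp: embedding_sets_def embedding_def)
  then show "J \<subseteq> I \<and> inj_on (\<lambda>a. restrict (f a) J) (carrier A)"
    by (simp add: inj_on_def)
next
  assume J: "J \<subseteq> I \<and> inj_on (\<lambda>a. restrict (f a) J) (carrier A)"
  have hom: "homomorphism \<Sigma> A (product_algebra I B) f"
    using f by (simp add: embedding_def)
  have "homomorphism \<Sigma> A (product_algebra J B) (\<lambda>a. restrict (f a) J)"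
    unfolding homomorphism_def
  proof (intro conjI ballI)
    fix a assume "a \<in> carrier A"
    then have "f a \<in> carrier (product_algebra I B)"
      using hom by (simp add: homomorphism_def)
    then show "restrict (f a) J \<in> carrier (product_algebra J B)"
      using J by (auto simp: product_algebra_def)
  next
    fix s xs assume "s \<in> symbols \<Sigma>" "xs \<in> argument_lists \<Sigma> A s"
    then have *: "f (opn A s xs) = opn (product_algebra I B) s (map f xs)"
      using hom by (simp add: homomorphism_def)
    show "restrict (f (opn A s xs)) J =
            opn (product_algebra J B) s (map (\<lambda>a. restrict (f a) J) xs)"
      unfolding * using J
      by (auto simp: product_algebra_def restrict_def fun_eq_iff comp_def)
  qed
  then show "J \<in> embedding_sets \<Sigma> A I B f"
    using J by (auto simp: embedding_sets_def embedding_def)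
qed

theorem kappa_subdirectly_irreducible_all_types:
  fixes \<kappa> :: "'k rel" and \<Sigma> :: "'f signature" and A :: "('f, 'a) algebra"
  assumes \<kappa>: "Card_order \<kappa>" and A: "is_algebra \<Sigma> A"
    and irr: "kappa_subdirectly_irreducible \<kappa> \<Sigma> A"
  shows "kappa_subdirectly_irreducible_in TYPE('i) TYPE('b) \<kappa> \<Sigma> A"
  unfolding kappa_subdirectly_irreducible_in_def
proof (intro allI impI)
  fix I :: "'i set" and B :: "'i \<Rightarrow> ('f, 'b) algebra" and f
  assume small: "|I| <o \<kappa>" and f: "embedding \<Sigma> A (product_algebra I B) f"
  have hom: "homomorphism \<Sigma> A (product_algebra I B) f" and inj: "inj_on f (carrier A)"
    using f by (simp_all add: embedding_def)
  have "|I| \<le>o |Field \<kappa>|"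
    using small card_of_Field_ordIso[OF \<kappa>] ordIso_symmetric ordLess_ordIso_trans
      ordLess_imp_ordLeq by blast
  then obtain h :: "'i \<Rightarrow> 'k" where h: "inj_on h I"
    using card_of_ordLeq[of I "Field \<kappa>"] by blast
  define K where "K = h ` I"
  have K_small: "|K| <o \<kappa>"
    unfolding K_def using card_of_image small by (rule ordLeq_ordLess_trans)
  define rep where "rep i a = (SOME a'. a' \<in> carrier A \<and> f a' i = f a i)" for i a
  have rep: "rep i a \<in> carrier A \<and> f (rep i a) i = f a i" if "a \<in> carrier A" for i a
    unfolding rep_def by (rule someI_ex) (use that in blast)
  have rep_eq: "rep i a = rep i b" if "f a i = f b i" for i a b
    using that by (simp add: rep_def)
  define e where "e = inv_into I h"
  have e: "e (h i) = i" if "i \<in> I" for i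
    using h that by (simp add: e_def)
  define C where "C k = \<lparr>carrier = rep (e k) ` carrier A,
                         opn = (\<lambda>s xs. rep (e k) (opn A s xs))\<rparr>" for k
  define g where "g a = (\<lambda>k\<in>K. rep (e k) a)" for a
  have C: "is_algebra \<Sigma> (C k)" for k
    unfolding is_algebra_def
  proof (intro ballI)
    fix s xs assume s: "s \<in> symbols \<Sigma>" "xs \<in> argument_lists \<Sigma> (C k) s"
    then have "xs \<in> argument_lists \<Sigma> A s"
      using rep by (fastforce simp: argument_lists_def C_def)
    then show "opn (C k) s xs \<in> carrier (C k)"
      using s A by (simp add: is_algebra_def C_def)
  qed
  have comp: "f (opn A s xs) i = opn (B i) s (map (\<lambda>a. f a i) xs)"
    if "s \<in> symbols \<Sigma>" "xs \<in> argument_lists \<Sigma> A s" "i \<in> I" for s xs i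
    using hom that by (simp add: homomorphism_def product_algebra_def comp_def)
  have "embedding \<Sigma> A (product_algebra K C) g"
    unfolding embedding_def homomorphism_def
  proof (intro conjI ballI)
    fix a assume "a \<in> carrier A"
    then show "g a \<in> carrier (product_algebra K C)"
      by (simp add: g_def product_algebra_def C_def)
  next
    fix s xs assume s: "s \<in> symbols \<Sigma>" "xs \<in> argument_lists \<Sigma> A s"
    have "rep (e k) (opn A s xs) = rep (e k) (opn A s (map (rep (e k)) xs))" if k: "k \<in> K" for k
    proof (rule rep_eq)
      have i: "e k \<in> I" using k e by (auto simp: K_def)
      have xs': "map (rep (e k)) xs \<in> argument_lists \<Sigma> A s"
        using s rep by (auto simp: argument_lists_def)
      have "map (\<lambda>a. f a (e k)) xs = map (\<lambda>a. f a (e k)) (map (rep (e k)) xs)"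
        using s rep by (auto simp: argument_lists_def)
      then show "f (opn A s xs) (e k) = f (opn A s (map (rep (e k)) xs)) (e k)"
        unfolding comp[OF s i] comp[OF s(1) xs' i] by (rule arg_cong)
    qed
    moreover have "map (\<lambda>b. b k) (map g xs) = map (rep (e k)) xs" if "k \<in> K" for k
      using that by (simp add: g_def)
    ultimately have "g (opn A s xs) k = opn (product_algebra K C) s (map g xs) k" for k
      by (simp only: g_def[of "opn A s xs"] product_algebra_def C_def restrict_def
          algebra.simps if_cancel cong: if_cong)
    then show "g (opn A s xs) = opn (product_algebra K C) s (map g xs)"
      by (rule ext)
  next
    show "inj_on g (carrier A)"
    proof (rule inj_onI)
      fix a b assume ab: "a \<in> carrier A" "b \<in> carrier A" "g a = g b"
      have "f a i = f b i" if i: "i \<in> I" for i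
      proof -
        have "rep i a = rep i b"
          using fun_cong[OF ab(3), of "h i"] i e by (simp add: g_def K_def)
        then show ?thesis using rep ab by metis
      qed
      moreover have "f a \<in> carrier (product_algebra I B)" "f b \<in> carrier (product_algebra I B)"
        using hom ab by (auto simp: homomorphism_def)
      ultimately have "f a = f b"
        by (auto simp: product_algebra_def intro: PiE_ext)
      then show "a = b" using inj ab by (auto dest: inj_onD)
    qed
  qed
  note g = this
  have "\<exists>k\<in>K. {k} \<in> embedding_sets \<Sigma> A K C g"
    using irr[unfolded kappa_subdirectly_irreducible_def kappa_subdirectly_irreducible_in_def,
        rule_format, OF K_small _ g] C by simp
  then obtain k where k: "k \<in> K" "{k} \<in> embedding_sets \<Sigma> A K C g"
    by blast
  have i: "e k \<in> I" using k e by (auto simp: K_def)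
  have "inj_on (\<lambda>a. restrict (g a) {k}) (carrier A)"
    using k in_embedding_sets_iff[OF g] by blast
  then have inj_k: "a = b" if "a \<in> carrier A" "b \<in> carrier A" "g a k = g b k" for a b
    using that by (auto simp: inj_on_def restrict_def fun_eq_iff)
  have "inj_on (\<lambda>a. restrict (f a) {e k}) (carrier A)"
  proof (rule inj_onI)
    fix a b assume ab: "a \<in> carrier A" "b \<in> carrier A" "restrict (f a) {e k} = restrict (f b) {e k}"
    have "f a (e k) = f b (e k)"
      using fun_cong[OF ab(3), of "e k"] by simp
    then show "a = b"
      using rep_eq[of a "e k" b] inj_k[OF ab(1,2)] by (simp add: g_def)
  qed
  then have "{e k} \<in> embedding_sets \<Sigma> A I B f"
    using in_embedding_sets_iff[OF f] i by blast
  then show "\<exists>i\<^sub>0\<in>I. {i\<^sub>0} \<in> embedding_sets \<Sigma> A I B f"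
    using i by blast
qed

text \<open>
  The operations of the ultraproduct do not depend on the chosen representatives.
\<close>

lemma equiv_ultraproduct_rel:
  "equiv (carrier (product_algebra I B)) (ultraproduct_rel I B U)"
proof (rule equivI)
  show "sym (ultraproduct_rel I B U)"
    by (rule symI) (simp add: ultraproduct_rel_def eq_commute)
  show "trans (ultraproduct_rel I B U)"
  proof (rule transI)
    fix a b c assume ab: "(a, b) \<in> ultraproduct_rel I B U" and bc: "(b, c) \<in> ultraproduct_rel I B U"
    have "eventually (\<lambda>i. a i = b i) U" "eventually (\<lambda>i. b i = c i) U"
      using ab bc by (simp_all add: ultraproduct_rel_def)
    then have "eventually (\<lambda>i. a i = c i) U"
      by eventually_elim simp
    then show "(a, c) \<in> ultraproduct_rel I B U"
      using ab bc by (simp add: ultraproduct_rel_def)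
  qed
qed (auto simp: ultraproduct_rel_def refl_on_def)

lemma homomorphism_ultraproduct_map:
  assumes B: "\<forall>i\<in>I. is_algebra \<Sigma> (B i)" and U: "U \<le> principal I"
  shows "homomorphism \<Sigma> (product_algebra I B) (ultraproduct I B U) (ultraproduct_map I B U)"
  unfolding homomorphism_def
proof (intro conjI ballI)
  let ?P = "product_algebra I B" and ?r = "ultraproduct_rel I B U"
  fix b assume "b \<in> carrier ?P"
  then show "ultraproduct_map I B U b \<in> carrier (ultraproduct I B U)"
    by (simp add: ultraproduct_map_def ultraproduct_def quotient_algebra_def quotientI)
next
  let ?P = "product_algebra I B" and ?r = "ultraproduct_rel I B U"
  fix s xs assume s: "s \<in> symbols \<Sigma>" and xs: "xs \<in> argument_lists \<Sigma> ?P s"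
  have closed: "opn ?P s ys \<in> carrier ?P" if ys: "ys \<in> argument_lists \<Sigma> ?P s" for ys
  proof -
    have "map (\<lambda>b. b i) ys \<in> argument_lists \<Sigma> (B i) s" if "i \<in> I" for i
      using ys that by (fastforce simp: argument_lists_def product_algebra_def)
    then show ?thesis
      using B s by (auto simp: is_algebra_def product_algebra_def)
  qed
  have cong: "?r `` {opn ?P s ys} = ?r `` {opn ?P s xs}"
    if ys: "list_all2 (\<in>) ys (map (ultraproduct_map I B U) xs)" for ys
  proof -
    have rel: "list_all2 (\<lambda>y x. (x, y) \<in> ?r) ys xs"
      using ys by (simp add: list_all2_map2 ultraproduct_map_def)
    have ys_arg: "ys \<in> argument_lists \<Sigma> ?P s"
      using rel xs
      by (auto simp: argument_lists_def list_all2_conv_all_nth in_set_conv_nth ultraproduct_rel_def)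
    have len: "length ys = length xs"
      using rel by (rule list_all2_lengthD)
    have "eventually (\<lambda>i. \<forall>n\<in>{..<length xs}. (xs ! n) i = (ys ! n) i) U"
      using rel len
      by (subst eventually_ball_finite_distrib)
         (auto simp: list_all2_conv_all_nth ultraproduct_rel_def)
    moreover have "eventually (\<lambda>i. i \<in> I) U"
      using U by (simp add: le_principal)
    ultimately have "eventually (\<lambda>i. opn ?P s xs i = opn ?P s ys i) U"
    proof eventually_elim
      case (elim i)
      then have "map (\<lambda>b. b i) xs = map (\<lambda>b. b i) ys"
        using len by (auto intro: nth_equalityI)
      then show ?case by (simp add: product_algebra_def)
    qed
    then have "(opn ?P s xs, opn ?P s ys) \<in> ?r"
      using closed xs ys_arg by (simp add: ultraproduct_rel_def)
    then show ?thesis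
      using equiv_class_eq[OF equiv_ultraproduct_rel] by blast
  qed
  have "list_all2 (\<in>) xs (map (ultraproduct_map I B U) xs)"
    using xs
    by (auto simp: list_all2_map2 list_all2_same ultraproduct_map_def argument_lists_def
        ultraproduct_rel_def)
  then have "(\<Union>ys \<in> {ys. list_all2 (\<in>) ys (map (ultraproduct_map I B U) xs)}. ?r `` {opn ?P s ys}) =
               ?r `` {opn ?P s xs}"
    using cong by blast
  then show "ultraproduct_map I B U (opn ?P s xs) =
               opn (ultraproduct I B U) s (map (ultraproduct_map I B U) xs)"
    unfolding ultraproduct_def quotient_algebra_def ultraproduct_map_def by simp
qed

end

theory Submission
  imports Defs
begin

text \<open>
  Call \<open>J \<subseteq> I\<close> separating if the coordinates in \<open>J\<close> already distinguish the elements of \<open>A\<close>;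
  \<open>\<U>(f)\<close> consists of the separating sets.  This collection is itself the required ultrafilter.

  Closure under supersets holds for every embedding, and indecomposability supplies the dichotomy
  between \<open>J\<close> and \<open>I - J\<close>; as \<open>I\<close> is separating, \<open>{}\<close> is not.  The substance is completeness, and
  its source is a covering principle (\<open>separating_member_of_cover\<close>): if fewer than \<open>\<kappa>\<close> subsets of
  \<open>I\<close> cover a separating set, then one of them is separating.  To see this, group the
  coordinates: sending \<open>a\<close> to the family of restrictions of \<open>f a\<close> to the members of the cover
  embeds \<open>A\<close> into a product of fewer than \<open>\<kappa>\<close> algebras, each a partial product of the \<open>B i\<close>, and
  \<open>\<kappa>\<close>-subdirect irreducibility singles out one member.

  Now let \<open>S\<close> consist of fewer than \<open>\<kappa>\<close> separating sets.  If the intersection of \<open>S\<close> were not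
  separating, its complement in \<open>I\<close> would be, and that complement is covered by the sets \<open>I - J\<close>
  for \<open>J \<in> S\<close>.  Some \<open>I - J\<close> would thus be separating along with \<open>J\<close>, which indecomposability
  forbids.  Finally, two elements of \<open>A\<close> with the same image in the ultraproduct agree on a
  separating set and are therefore equal.
\<close>

section \<open>Products and compositions\<close>

lemma is_algebra_product_algebra:
  assumes "\<forall>i\<in>I. is_algebra \<Sigma> (B i)"
  shows "is_algebra \<Sigma> (product_algebra I B)"
  unfolding is_algebra_def
proof (intro ballI)
  fix s xs assume s: "s \<in> symbols \<Sigma>" and xs: "xs \<in> argument_lists \<Sigma> (product_algebra I B) s"
  have "map (\<lambda>b. b i) xs \<in> argument_lists \<Sigma> (B i) s" if "i \<in> I" for i
    using xs that by (fastforce simp: argument_lists_def product_algebra_def)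
  then show "opn (product_algebra I B) s xs \<in> carrier (product_algebra I B)"
    using assms s by (auto simp: is_algebra_def product_algebra_def)
qed

lemma homomorphism_comp:
  assumes g: "homomorphism \<Sigma> A B g" and h: "homomorphism \<Sigma> B C h"
  shows "homomorphism \<Sigma> A C (h \<circ> g)"
  unfolding homomorphism_def
proof (intro conjI ballI)
  fix a assume "a \<in> carrier A"
  then show "(h \<circ> g) a \<in> carrier C"
    using g h by (simp add: homomorphism_def)
next
  fix s xs assume s: "s \<in> symbols \<Sigma>" and xs: "xs \<in> argument_lists \<Sigma> A s"
  have "map g xs \<in> argument_lists \<Sigma> B s"
    using g xs by (auto simp: argument_lists_def homomorphism_def)
  then show "(h \<circ> g) (opn A s xs) = opn C s (map (h \<circ> g) xs)"
    using g h s xs by (simp add: homomorphism_def)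
qed

lemma homomorphism_into_product_iff:
  "homomorphism \<Sigma> A (product_algebra I B) (\<lambda>a. \<lambda>i\<in>I. h i a) \<longleftrightarrow>
     (\<forall>i\<in>I. homomorphism \<Sigma> A (B i) (h i))"
  (is "homomorphism \<Sigma> A ?P ?h \<longleftrightarrow> _")
proof -
  have "?h a \<in> carrier ?P \<longleftrightarrow> (\<forall>i\<in>I. h i a \<in> carrier (B i))" for a
    by (simp add: product_algebra_def PiE_iff)
  moreover have "?h (opn A s xs) = opn ?P s (map ?h xs) \<longleftrightarrow>
      (\<forall>i\<in>I. h i (opn A s xs) = opn (B i) s (map (h i) xs))" for s xs
    by (auto simp: product_algebra_def restrict_def fun_eq_iff comp_def)
  ultimately show ?thesis
    unfolding homomorphism_def by (simp only:) blast
qed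

section \<open>Separating sets of coordinates\<close>

lemma embedding_setsD:
  assumes "J \<in> embedding_sets \<Sigma> A I B f" "a \<in> carrier A" "b \<in> carrier A"
    and "\<And>i. i \<in> J \<Longrightarrow> f a i = f b i"
  shows "a = b"
proof -
  obtain g where "inj_on g (carrier A)" "\<forall>a \<in> carrier A. restrict (f a) J = g a"
    using assms(1) by (auto simp: embedding_sets_def embedding_def)
  moreover have "restrict (f a) J = restrict (f b) J"
    using assms(4) by (auto simp: restrict_def)
  ultimately show ?thesis
    using assms(2,3) by (auto dest: inj_onD)
qed

lemma embedding_setsI:
  assumes "embedding \<Sigma> A (product_algebra I B) f" "J \<subseteq> I"
    and "\<And>a b. \<lbrakk>a \<in> carrier A; b \<in> carrier A; \<And>i. i \<in> J \<Longrightarrow> f a i = f b i\<rbrakk> \<Longrightarrow> a = b"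
  shows "J \<in> embedding_sets \<Sigma> A I B f"
  unfolding in_embedding_sets_iff[OF assms(1)]
  using assms(2,3) by (auto intro!: inj_onI) (metis restrict_apply')

lemma embedding_sets_mono:
  assumes "embedding \<Sigma> A (product_algebra I B) f"
    and "J \<in> embedding_sets \<Sigma> A I B f" "J \<subseteq> K" "K \<subseteq> I"
  shows "K \<in> embedding_sets \<Sigma> A I B f"
  using assms(1,4)
proof (rule embedding_setsI)
  fix a b assume "a \<in> carrier A" "b \<in> carrier A" "\<And>i. i \<in> K \<Longrightarrow> f a i = f b i"
  then show "a = b"
    using embedding_setsD[OF assms(2)] assms(3) by blast
qed

lemma whole_in_embedding_sets:
  assumes f: "embedding \<Sigma> A (product_algebra I B) f"
  shows "I \<in> embedding_sets \<Sigma> A I B f"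
proof -
  have "restrict (f a) I = f a" if "a \<in> carrier A" for a
    using f that by (auto simp: embedding_def homomorphism_def product_algebra_def
        intro: extensional_restrict)
  then show ?thesis
    using f by (auto simp: embedding_sets_def)
qed

text \<open>
  A projection of the product over \<open>I\<close> onto a partial product is a homomorphism, so the members of
  a cover can serve as the indices of a coarser product, to which irreducibility applies.
\<close>

lemma separating_member_of_cover:
  fixes \<kappa> :: "'k rel" and A :: "('f, 'a) algebra" and B :: "'i \<Rightarrow> ('f, 'b) algebra"
  assumes irr: "kappa_subdirectly_irreducible_in TYPE('i set) TYPE('i \<Rightarrow> 'b) \<kappa> \<Sigma> A"
    and B: "\<forall>i\<in>I. is_algebra \<Sigma> (B i)"
    and f: "embedding \<Sigma> A (product_algebra I B) f"
    and J0: "J0 \<in> embedding_sets \<Sigma> A I B f" "J0 \<subseteq> \<Union>S"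
    and S: "S \<subseteq> Pow I" "|S| <o \<kappa>"
  shows "\<exists>J\<in>S. J \<in> embedding_sets \<Sigma> A I B f"
proof -
  define C where "C J = product_algebra J B" for J
  define g where "g a = (\<lambda>J\<in>S. restrict (f a) J)" for a
  have C: "\<forall>J\<in>S. is_algebra \<Sigma> (C J)"
    unfolding C_def using S(1) B by (blast intro: is_algebra_product_algebra)
  have hom_J: "homomorphism \<Sigma> A (C J) (\<lambda>a. restrict (f a) J)" if "J \<in> S" for J
  proof -
    have "homomorphism \<Sigma> A (product_algebra I B) f"
      using f by (simp add: embedding_def)
    then have "homomorphism \<Sigma> A (B i) (\<lambda>a. f a i)" if "i \<in> I" for i
      using that by (auto simp: homomorphism_def product_algebra_def comp_def)
    then show ?thesis
      using \<open>J \<in> S\<close> S(1) unfolding C_def homomorphism_into_product_iff by blast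
  qed
  have g: "embedding \<Sigma> A (product_algebra S C) g"
    unfolding embedding_def
  proof
    show "homomorphism \<Sigma> A (product_algebra S C) g"
      unfolding g_def homomorphism_into_product_iff using hom_J by blast
    show "inj_on g (carrier A)"
    proof (rule inj_onI)
      fix a b assume ab: "a \<in> carrier A" "b \<in> carrier A" "g a = g b"
      show "a = b"
      proof (rule embedding_setsD[OF J0(1) ab(1,2)])
        fix i assume "i \<in> J0"
        then obtain J where J: "J \<in> S" "i \<in> J"
          using J0(2) by blast
        then show "f a i = f b i"
          using fun_cong[OF fun_cong[OF ab(3)], of J i] by (simp add: g_def)
      qed
    qed
  qed
  obtain J where J: "J \<in> S" "{J} \<in> embedding_sets \<Sigma> A S C g"
    using irr S(2) C g unfolding kappa_subdirectly_irreducible_in_def by blast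
  have "J \<in> embedding_sets \<Sigma> A I B f"
  proof (rule embedding_setsI[OF f])
    show "J \<subseteq> I"
      using J(1) S(1) by blast
    fix a b assume ab: "a \<in> carrier A" "b \<in> carrier A" and eq: "\<And>i. i \<in> J \<Longrightarrow> f a i = f b i"
    have "restrict (f a) J = restrict (f b) J"
      using eq by (auto simp: restrict_def)
    then show "a = b"
      by (intro embedding_setsD[OF J(2) ab]) (simp add: g_def)
  qed
  then show ?thesis
    using J(1) by blast
qed

lemma embedding_sets_Inter:
  fixes \<kappa> :: "'k rel" and A :: "('f, 'a) algebra" and B :: "'i \<Rightarrow> ('f, 'b) algebra"
  assumes irr: "kappa_subdirectly_irreducible_in TYPE('i set) TYPE('i \<Rightarrow> 'b) \<kappa> \<Sigma> A"
    and B: "\<forall>i\<in>I. is_algebra \<Sigma> (B i)"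
    and indec: "indecomposable_embedding \<Sigma> A I B f"
    and S: "S \<subseteq> embedding_sets \<Sigma> A I B f" "|S| <o \<kappa>"
  shows "I \<inter> \<Inter>S \<in> embedding_sets \<Sigma> A I B f"
proof (rule ccontr)
  assume "I \<inter> \<Inter>S \<notin> embedding_sets \<Sigma> A I B f"
  moreover have dich: "(J \<in> embedding_sets \<Sigma> A I B f) \<noteq> (I - J \<in> embedding_sets \<Sigma> A I B f)"
    if "J \<subseteq> I" for J
    using indec that unfolding indecomposable_embedding_def by blast
  ultimately have compl: "I - I \<inter> \<Inter>S \<in> embedding_sets \<Sigma> A I B f"
    by blast
  have "\<exists>K \<in> (\<lambda>J. I - J) ` S. K \<in> embedding_sets \<Sigma> A I B f"
  proof (rule separating_member_of_cover[OF irr B _ compl])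
    show "embedding \<Sigma> A (product_algebra I B) f"
      using indec by (simp add: indecomposable_embedding_def)
    show "|(\<lambda>J. I - J) ` S| <o \<kappa>"
      using card_of_image S(2) by (rule ordLeq_ordLess_trans)
  qed auto
  then obtain J where "J \<in> S" "I - J \<in> embedding_sets \<Sigma> A I B f"
    by blast
  moreover from this have "J \<in> embedding_sets \<Sigma> A I B f"
    using S(1) by blast
  moreover from this have "J \<subseteq> I"
    by (simp add: embedding_sets_def)
  ultimately show False
    using dich by blast
qed

section \<open>The ultrafilter of separating sets\<close>

theorem mainTheorem1:
  fixes \<kappa> :: "'k rel"
    and \<Sigma> :: "'f signature"
    and A :: "('f, 'a) algebra"
    and I :: "'i set"
    and B :: "'i \<Rightarrow> ('f, 'b) algebra"
    and f :: "'a \<Rightarrow> 'i \<Rightarrow> 'b"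
  assumes "Cinfinite \<kappa>"
    and "is_algebra \<Sigma> A"
    and "kappa_subdirectly_irreducible \<kappa> \<Sigma> A"
    and "\<forall>i\<in>I. is_algebra \<Sigma> (B i)"
    and "indecomposable_embedding \<Sigma> A I B f"
  shows "\<exists>U. ultrafilter_on I U \<and> kappa_complete \<kappa> U \<and>
             embedding \<Sigma> A (ultraproduct I B U) (ultraproduct_map I B U \<circ> f)"
proof -
  let ?W = "embedding_sets \<Sigma> A I B f"
  have f: "embedding \<Sigma> A (product_algebra I B) f"
    using assms(5) by (simp add: indecomposable_embedding_def)
  have dich: "(J \<in> ?W) \<noteq> (I - J \<in> ?W)" if "J \<subseteq> I" for J
    using assms(5) that unfolding indecomposable_embedding_def by blast
  have irr: "kappa_subdirectly_irreducible_in TYPE('i set) TYPE('i \<Rightarrow> 'b) \<kappa> \<Sigma> A"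
    using assms(1-3) by (blast intro: kappa_subdirectly_irreducible_all_types)
  note Inter = embedding_sets_Inter[OF irr assms(4,5)]
  have I_W: "I \<in> ?W"
    using f by (rule whole_in_embedding_sets)
  define U where "U = Abs_filter (\<lambda>P. {i\<in>I. P i} \<in> ?W)"
  have "is_filter (\<lambda>P. {i\<in>I. P i} \<in> ?W)"
  proof
    show "{i\<in>I. True} \<in> ?W"
      using I_W by simp
  next
    fix P Q assume PQ: "{i\<in>I. P i} \<in> ?W" "{i\<in>I. Q i} \<in> ?W"
    \<comment> \<open>A two-element family counts as small because \<open>\<kappa>\<close> is infinite.\<close>
    have "|{{i\<in>I. P i}, {i\<in>I. Q i}}| <o \<kappa>"
      using assms(1) unfolding cinfinite_def
      by (intro finite_ordLess_infinite[OF card_of_Well_order])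
        (simp_all only: Field_card_of card_order_on_well_order_on finite.intros simp_thms)
    then have "I \<inter> \<Inter>{{i\<in>I. P i}, {i\<in>I. Q i}} \<in> ?W"
      using PQ by (intro Inter) auto
    moreover have "I \<inter> \<Inter>{{i\<in>I. P i}, {i\<in>I. Q i}} = {i\<in>I. P i \<and> Q i}"
      by blast
    ultimately show "{i\<in>I. P i \<and> Q i} \<in> ?W"
      by simp
  next
    fix P Q assume imp: "\<forall>i. P i \<longrightarrow> Q i" and P: "{i\<in>I. P i} \<in> ?W"
    show "{i\<in>I. Q i} \<in> ?W"
      using imp by (intro embedding_sets_mono[OF f P]) blast+
  qed
  then have ev: "eventually P U \<longleftrightarrow> {i\<in>I. P i} \<in> ?W" for P
    unfolding U_def by (rule eventually_Abs_filter)
  have U_I: "U \<le> principal I"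
    using I_W by (simp add: le_principal ev)
  have "ultrafilter_on I U"
    unfolding ultrafilter_on_def
  proof (intro conjI allI impI)
    show "U \<le> principal I"
      by (rule U_I)
    have "{} \<notin> ?W"
      using dich[of I] I_W by (metis Diff_cancel order_refl)
    then show "U \<noteq> bot"
      by (auto simp: trivial_limit_def ev)
    fix J assume J: "J \<subseteq> I"
    then have "{i\<in>I. i \<in> J} = J" "{i\<in>I. i \<in> I - J} = I - J"
      by auto
    then show "eventually (\<lambda>i. i \<in> J) U \<or> eventually (\<lambda>i. i \<in> I - J) U"
      using dich[OF J] unfolding ev by metis
  qed
  moreover have "kappa_complete \<kappa> U"
    unfolding kappa_complete_def
  proof (intro allI impI)
    fix S :: "'i set set" assume S: "|S| <o \<kappa>" "\<forall>J\<in>S. eventually (\<lambda>i. i \<in> J) U"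
    \<comment> \<open>Members of the filter may stick out of \<open>I\<close>, so they are cut down to it first.\<close>
    define T where "T = (\<lambda>J. {i\<in>I. i \<in> J}) ` S"
    have "|T| <o \<kappa>"
      unfolding T_def using card_of_image S(1) by (rule ordLeq_ordLess_trans)
    then have "I \<inter> \<Inter>T \<in> ?W"
      using S(2) by (intro Inter) (auto simp: T_def ev)
    moreover have "I \<inter> \<Inter>T = {i\<in>I. i \<in> \<Inter>S}"
      by (auto simp: T_def)
    ultimately show "eventually (\<lambda>i. i \<in> \<Inter>S) U"
      unfolding ev by simp
  qed
  moreover have "embedding \<Sigma> A (ultraproduct I B U) (ultraproduct_map I B U \<circ> f)"
    unfolding embedding_def
  proof
    have hom: "homomorphism \<Sigma> A (product_algebra I B) f"
      using f by (simp add: embedding_def)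
    then show "homomorphism \<Sigma> A (ultraproduct I B U) (ultraproduct_map I B U \<circ> f)"
      by (rule homomorphism_comp) (rule homomorphism_ultraproduct_map[OF assms(4) U_I])
    show "inj_on (ultraproduct_map I B U \<circ> f) (carrier A)"
    proof (rule inj_onI)
      fix a b assume ab: "a \<in> carrier A" "b \<in> carrier A"
        and eq: "(ultraproduct_map I B U \<circ> f) a = (ultraproduct_map I B U \<circ> f) b"
      have "f b \<in> carrier (product_algebra I B)"
        using hom ab by (simp add: homomorphism_def)
      then have "(f a, f b) \<in> ultraproduct_rel I B U"
        using eq eq_equiv_class[OF _ equiv_ultraproduct_rel] by (auto simp: ultraproduct_map_def)
      then have "{i\<in>I. f a i = f b i} \<in> ?W"
        by (simp add: ultraproduct_rel_def ev)
      then show "a = b"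
        using ab by (rule embedding_setsD) simp
    qed
  qed
  ultimately show ?thesis
    by blast
qed

end
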